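(* Let $f\in\mathcal{C}(\Omega)$ and $\lambda>0$, and let the quadrature rule have exactness degree $2n$. Then: (a) $\mathcal{H}_n^{\lambda}$ is idempotent: $\mathcal{H}_n^{\lambda}(\mathcal{H}_n^{\lambda}f)=\mathcal{H}_n^{\lambda}f$; (b) $\mathcal{H}_n^{\lambda}(\mathcal{L}_nf)=\mathcal{L}_n(\mathcal{H}_n^{\lambda}f)=\mathcal{H}_n^{\lambda}f$.
   Context: $\Omega\subset\mathbb{R}^s$ is a compact smooth Riemannian manifold with smooth or empty boundary, equipped with a measure $\mathrm{d}\omega$ with $\int_\Omega \mathrm{d}\omega=V<\infty$. $\mathcal{C}(\Omega)$ is the space of continuous real functions on $\Omega$, and $\langle f,g\rangle=\int_\Omega fg\,\mathrm{d}\omega$. $\mathbb{P}_n(\Omega)$ is the space of polynomials of total degree at most $n$ restricted to $\Omega$, $d_n=\dim\mathbb{P}_n(\Omega)$, and $\{\Phi_\ell\}_{\ell=1}^{d_n}$ is a fixed orthonormal basis of $\mathbb{P}_n(\Omega)$ with respect to $\langle\cdot,\cdot\rangle$. Quadrature rule: nodes $\mathbf{x}_1,\dots,\mathbf{x}_N\in\Omega$ and weights $w_1,\dots,w_N>0$ such that $\int_\Omega p\,\mathrm{d}\omega=\sum_{j=1}^N w_jp(\mathbf{x}_j)$ for all $p\in\mathbb{P}_{2n}(\Omega)$ (exactness degree $2n$). The discrete (semi) inner product is $\langle f,g\rangle_N=\sum_{j=1}^N w_jf(\mathbf{x}_j)g(\mathbf{x}_j)$. The hyperinterpolation of $f$ is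 $\mathcal{L}_nf=\sum_{\ell=1}^{d_n}\langle f,\Phi_\ell\rangle_N\Phi_\ell$. The hard thresholding operator is $\eta_H(a,k)=a$ if $|a|>k$ and $\eta_H(a,k)=0$ if $|a|\le k$. The hard thresholding hyperinterpolation of $f$ is $\mathcal{H}_n^\lambda f=\sum_{\ell=1}^{d_n}\eta_H(\langle f,\Phi_\ell\rangle_N,\lambda)\Phi_\ell$, $\lambda>0$. *)

theory Defs
  imports "HOL-Analysis.Analysis" "HOL-Library.Function_Algebras"
begin

section \<open>Smooth submanifolds of Euclidean space\<close>

text \<open>
  \<open>Ck_on k f U\<close> says that \<open>f\<close> is \<open>k\<close> times continuously differentiable. Derivatives are taken
  with respect to full neighbourhoods, so the notion is only used for open \<open>U\<close>.
\<close>

primrec Ck_on :: "nat \<Rightarrow> ('a::euclidean_space \<Rightarrow> 'b::real_normed_vector) \<Rightarrow> 'a set \<Rightarrow> bool" where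
  "Ck_on 0 f U \<longleftrightarrow> continuous_on U f"
| "Ck_on (Suc k) f U \<longleftrightarrow>
     f differentiable_on U \<and> (\<forall>v. Ck_on k (\<lambda>x. frechet_derivative f (at x) v) U)"

definition diffeomorphism ::
  "'a::euclidean_space set \<Rightarrow> 'b::euclidean_space set \<Rightarrow> ('a \<Rightarrow> 'b) \<Rightarrow> ('b \<Rightarrow> 'a) \<Rightarrow> bool" where
  "diffeomorphism U V \<phi> \<psi> \<longleftrightarrow>
     open U \<and> open V \<and> homeomorphism U V \<phi> \<psi> \<and> (\<forall>k. Ck_on k \<phi> U) \<and> (\<forall>k. Ck_on k \<psi> V)"

text \<open>
  Smooth embedded submanifolds with (possibly empty) boundary, by slice charts: locally, a
  diffeomorphism of the ambient space carries \<open>M\<close> to a \<open>d\<close>-dimensional linear subspace \<open>E\<close> (the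
  case \<open>b = 0\<close>) or to a closed half-space of such an \<open>E\<close> (the case \<open>b \<noteq> 0\<close>). The Riemannian
  metric is the one induced by the ambient Euclidean inner product, hence no additional datum.
\<close>

definition smooth_submanifold :: "nat \<Rightarrow> 'a::euclidean_space set \<Rightarrow> bool" where
  "smooth_submanifold d M \<longleftrightarrow>
     (\<forall>p\<in>M. \<exists>(U :: 'a set) (V :: 'a set) \<phi> \<psi> E b.
        p \<in> U \<and> diffeomorphism U V \<phi> \<psi> \<and>
        subspace E \<and> dim E = d \<and> b \<in> E \<and>
        \<phi> ` (U \<inter> M) = V \<inter> {y \<in> E. 0 \<le> b \<bullet> y})"


section \<open>Polynomials on a region\<close>

global_interpretation fun_space: vector_space "\<lambda>c (f :: 'a \<Rightarrow> real) x. c * f x"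
  defines fun_span = fun_space.span
    and fun_dim = fun_space.dim
    and fun_dependent = fun_space.dependent
  by unfold_locales (auto simp: fun_eq_iff algebra_simps)

text \<open>
  A function on \<open>\<Omega>\<close> is represented by its extension by zero to the ambient space. This is a
  linear isomorphism onto the functions vanishing off \<open>\<Omega>\<close>, so spans, dimensions and equality
  are those of the functions on \<open>\<Omega>\<close>.
\<close>

definition monomial_on :: "(real ^ 's) set \<Rightarrow> ('s \<Rightarrow> nat) \<Rightarrow> real ^ 's \<Rightarrow> real" where
  "monomial_on \<Omega> \<alpha> = (\<lambda>x. if x \<in> \<Omega> then (\<Prod>i\<in>UNIV. (x $ i) ^ \<alpha> i) else 0)"

definition poly_space :: "nat \<Rightarrow> (real ^ 's) set \<Rightarrow> (real ^ 's \<Rightarrow> real) set" where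
  "poly_space n \<Omega> = fun_span {monomial_on \<Omega> \<alpha> | \<alpha>. (\<Sum>i\<in>UNIV. \<alpha> i) \<le> n}"

definition poly_dim :: "nat \<Rightarrow> (real ^ 's) set \<Rightarrow> nat" where
  "poly_dim n \<Omega> = fun_dim (poly_space n \<Omega>)"

definition L2_inner :: "'a measure \<Rightarrow> ('a \<Rightarrow> real) \<Rightarrow> ('a \<Rightarrow> real) \<Rightarrow> real" where
  "L2_inner \<mu> f g = (\<integral>x. f x * g x \<partial>\<mu>)"

definition orthonormal_poly_basis ::
  "nat \<Rightarrow> (real ^ 's) set \<Rightarrow> (real ^ 's) measure \<Rightarrow> (nat \<Rightarrow> real ^ 's \<Rightarrow> real) \<Rightarrow> bool" where
  "orthonormal_poly_basis n \<Omega> \<mu> \<Phi> \<longleftrightarrow>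
     inj_on \<Phi> {1..poly_dim n \<Omega>} \<and>
     \<not> fun_dependent (\<Phi> ` {1..poly_dim n \<Omega>}) \<and>
     fun_span (\<Phi> ` {1..poly_dim n \<Omega>}) = poly_space n \<Omega> \<and>
     (\<forall>k\<in>{1..poly_dim n \<Omega>}. \<forall>l\<in>{1..poly_dim n \<Omega>}.
        L2_inner \<mu> (\<Phi> k) (\<Phi> l) = (if k = l then 1 else 0))"


section \<open>Quadrature and hyperinterpolation\<close>

definition quadrature_rule ::
  "(real ^ 's) set \<Rightarrow> nat \<Rightarrow> (nat \<Rightarrow> real ^ 's) \<Rightarrow> (nat \<Rightarrow> real) \<Rightarrow> bool" where
  "quadrature_rule \<Omega> N x w \<longleftrightarrow> (\<forall>j\<in>{1..N}. x j \<in> \<Omega> \<and> 0 < w j)"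

definition quadrature_exact ::
  "nat \<Rightarrow> (real ^ 's) set \<Rightarrow> (real ^ 's) measure \<Rightarrow>
     nat \<Rightarrow> (nat \<Rightarrow> real ^ 's) \<Rightarrow> (nat \<Rightarrow> real) \<Rightarrow> bool" where
  "quadrature_exact m \<Omega> \<mu> N x w \<longleftrightarrow>
     (\<forall>p\<in>poly_space m \<Omega>. (\<integral>y. p y \<partial>\<mu>) = (\<Sum>j=1..N. w j * p (x j)))"

definition discrete_inner ::
  "nat \<Rightarrow> (nat \<Rightarrow> 'a) \<Rightarrow> (nat \<Rightarrow> real) \<Rightarrow> ('a \<Rightarrow> real) \<Rightarrow> ('a \<Rightarrow> real) \<Rightarrow> real" where
  "discrete_inner N x w f g = (\<Sum>j=1..N. w j * f (x j) * g (x j))"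

definition hard_threshold :: "real \<Rightarrow> real \<Rightarrow> real" where
  "hard_threshold a k = (if \<bar>a\<bar> > k then a else 0)"

definition hyperinterpolation ::
  "nat \<Rightarrow> (real ^ 's) set \<Rightarrow> (nat \<Rightarrow> real ^ 's \<Rightarrow> real) \<Rightarrow>
     nat \<Rightarrow> (nat \<Rightarrow> real ^ 's) \<Rightarrow> (nat \<Rightarrow> real) \<Rightarrow> (real ^ 's \<Rightarrow> real) \<Rightarrow> real ^ 's \<Rightarrow> real" where
  "hyperinterpolation n \<Omega> \<Phi> N x w f =
     (\<lambda>y. \<Sum>l=1..poly_dim n \<Omega>. discrete_inner N x w f (\<Phi> l) * \<Phi> l y)"

definition hard_hyperinterpolation ::
  "nat \<Rightarrow> (real ^ 's) set \<Rightarrow> (nat \<Rightarrow> real ^ 's \<Rightarrow> real) \<Rightarrow>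
     nat \<Rightarrow> (nat \<Rightarrow> real ^ 's) \<Rightarrow> (nat \<Rightarrow> real) \<Rightarrow> real \<Rightarrow>
     (real ^ 's \<Rightarrow> real) \<Rightarrow> real ^ 's \<Rightarrow> real" where
  "hard_hyperinterpolation n \<Omega> \<Phi> N x w k f =
     (\<lambda>y. \<Sum>l=1..poly_dim n \<Omega>. hard_threshold (discrete_inner N x w f (\<Phi> l)) k * \<Phi> l y)"

end

theory Submission
  imports Defs
begin

text \<open>
  Exactness of degree \<open>2 * n\<close> makes the basis orthonormal for the discrete inner product too, so a
  combination of basis functions has its own coefficients as discrete Fourier coefficients.
  All three identities then reduce to idempotence of scalar hard thresholding.
\<close>

text \<open>The product is bilinear, so membership in the span of \<open>C\<close> needs checking
  only on pairs of generators. Two nested span inductions carry this out, one for each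
  factor.\<close>

lemma fun_span_times:
  fixes f g :: "'a \<Rightarrow> real"
  assumes "f \<in> fun_span A" "g \<in> fun_span B"
    and mult: "\<And>a b. a \<in> A \<Longrightarrow> b \<in> B \<Longrightarrow> (\<lambda>x. a x * b x) \<in> fun_span C"
  shows "(\<lambda>x. f x * g x) \<in> fun_span C"
proof -
  \<comment> \<open>The first factor stays a generator while the second ranges over its span; the
    outer induction then releases the first factor.\<close>
  have gen: "(\<lambda>x. a x * g x) \<in> fun_span C" if "a \<in> A" for a
    using assms(2)
  proof (induction rule: fun_space.span_induct_alt)
    case base
    show ?case
      using fun_space.span_zero[of C] by (simp add: zero_fun_def)
  next
    case (step c b h)
    \<comment> \<open>The product is regrouped as a scalar multiple plus a remainder, the form that
      the closure rules of a span accept; \<open>+\<close> is pointwise addition of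
      functions.\<close>
    have "(\<lambda>x. c * (a x * b x)) + (\<lambda>x. a x * h x) \<in> fun_span C"
      using mult[OF that step(1)] step(2)
      by (intro fun_space.span_add fun_space.span_scale[of "\<lambda>x. a x * b x"])
    then show ?case
      by (simp add: plus_fun_def algebra_simps)
  qed
  show ?thesis
    using assms(1)
  proof (induction rule: fun_space.span_induct_alt)
    case base
    show ?case
      using fun_space.span_zero[of C] by (simp add: zero_fun_def)
  next
    case (step c a h)
    have "(\<lambda>x. c * (a x * g x)) + (\<lambda>x. h x * g x) \<in> fun_span C"
      using gen[OF step(1)] step(2)
      by (intro fun_space.span_add fun_space.span_scale[of "\<lambda>x. a x * g x"])
    then show ?case
      by (simp add: plus_fun_def algebra_simps)
  qed
qed

lemma monomial_on_times:
  "(\<lambda>x. monomial_on \<Omega> \<alpha> x * monomial_on \<Omega> \<beta> x) = monomial_on \<Omega> (\<lambda>i. \<alpha> i + \<beta> i)"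
  by (auto simp: monomial_on_def fun_eq_iff power_add prod.distrib)

text \<open>Multiplying monomials adds their exponents, and hence their total degrees; bilinearity
  does the rest.\<close>

lemma poly_space_times:
  assumes "p \<in> poly_space m \<Omega>" "q \<in> poly_space n \<Omega>"
  shows "(\<lambda>x. p x * q x) \<in> poly_space (m + n) \<Omega>"
  using assms unfolding poly_space_def
proof (rule fun_span_times)
  fix a b
  assume "a \<in> {monomial_on \<Omega> \<alpha> | \<alpha>. (\<Sum>i\<in>UNIV. \<alpha> i) \<le> m}"
    and "b \<in> {monomial_on \<Omega> \<alpha> | \<alpha>. (\<Sum>i\<in>UNIV. \<alpha> i) \<le> n}"
  then obtain \<alpha> \<beta> where "a = monomial_on \<Omega> \<alpha>" "b = monomial_on \<Omega> \<beta>"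
    and "(\<Sum>i\<in>UNIV. \<alpha> i + \<beta> i) \<le> m + n"
    by (force simp: sum.distrib)
  then show "(\<lambda>x. a x * b x) \<in> fun_span {monomial_on \<Omega> \<alpha> | \<alpha>. (\<Sum>i\<in>UNIV. \<alpha> i) \<le> m + n}"
    by (auto simp: monomial_on_times intro!: fun_space.span_base)
qed

text \<open>This is where exactness degree \<open>2 * n\<close> enters: the product of two elements
  of \<open>poly_space n \<Omega>\<close> is integrated exactly by the rule.\<close>

lemma discrete_inner_eq_L2_inner:
  assumes "quadrature_exact (2 * n) \<Omega> \<mu> N x w" "p \<in> poly_space n \<Omega>" "q \<in> poly_space n \<Omega>"
  shows "discrete_inner N x w p q = L2_inner \<mu> p q"
  using assms(1) poly_space_times[OF assms(2,3)]
  by (simp add: quadrature_exact_def discrete_inner_def L2_inner_def mult_2 mult.assoc)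

lemma discrete_inner_sum_left:
  "discrete_inner N x w (\<lambda>y. \<Sum>l\<in>A. c l * \<Phi> l y) g = (\<Sum>l\<in>A. c l * discrete_inner N x w (\<Phi> l) g)"
  unfolding discrete_inner_def sum_distrib_left sum_distrib_right
  by (subst sum.swap) (simp add: mult_ac)

text \<open>The coefficients \<open>c\<close> are arbitrary, so the result covers both plain and
  thresholded expansions.\<close>

lemma discrete_inner_basis_expansion:
  assumes basis: "orthonormal_poly_basis n \<Omega> \<mu> \<Phi>"
    and exact: "quadrature_exact (2 * n) \<Omega> \<mu> N x w"
    and k: "k \<in> {1..poly_dim n \<Omega>}"
  shows "discrete_inner N x w (\<lambda>y. \<Sum>l=1..poly_dim n \<Omega>. c l * \<Phi> l y) (\<Phi> k) = c k"
proof -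
  have mem: "\<Phi> l \<in> poly_space n \<Omega>" if "l \<in> {1..poly_dim n \<Omega>}" for l
    using basis that fun_space.span_base[of "\<Phi> l" "\<Phi> ` {1..poly_dim n \<Omega>}"]
    by (simp add: orthonormal_poly_basis_def)
  \<comment> \<open>The discrete Gram matrix of the basis is the identity, so only the term
    \<open>l = k\<close> survives.\<close>
  have "(\<Sum>l=1..poly_dim n \<Omega>. c l * discrete_inner N x w (\<Phi> l) (\<Phi> k))
      = (\<Sum>l=1..poly_dim n \<Omega>. if l = k then c l else 0)"
    using basis k
    by (intro sum.cong)
      (auto simp: discrete_inner_eq_L2_inner[OF exact mem mem] orthonormal_poly_basis_def)
  then show ?thesis
    using k by (simp add: discrete_inner_sum_left)
qed

lemma hard_threshold_idem: "hard_threshold (hard_threshold a k) k = hard_threshold a k"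
  by (simp add: hard_threshold_def)

theorem theorem3p1:
  fixes \<Omega> :: "(real ^ 's) set"
    and \<mu> :: "(real ^ 's) measure"
    and n d N :: nat
    and \<Phi> :: "nat \<Rightarrow> real ^ 's \<Rightarrow> real"
    and x :: "nat \<Rightarrow> real ^ 's"
    and w :: "nat \<Rightarrow> real"
    and f :: "real ^ 's \<Rightarrow> real"
    and lam :: real
  assumes "compact \<Omega>"
    and "smooth_submanifold d \<Omega>"
    and "sets \<mu> = sets (restrict_space borel \<Omega>)"
    and "finite_measure \<mu>"
    and "orthonormal_poly_basis n \<Omega> \<mu> \<Phi>"
    and "quadrature_rule \<Omega> N x w"
    and "quadrature_exact (2 * n) \<Omega> \<mu> N x w"
    and "continuous_on \<Omega> f"
    and "lam > 0"
  shows "hard_hyperinterpolation n \<Omega> \<Phi> N x w lam (hard_hyperinterpolation n \<Omega> \<Phi> N x w lam f)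
           = hard_hyperinterpolation n \<Omega> \<Phi> N x w lam f
       \<and> hard_hyperinterpolation n \<Omega> \<Phi> N x w lam (hyperinterpolation n \<Omega> \<Phi> N x w f)
           = hyperinterpolation n \<Omega> \<Phi> N x w (hard_hyperinterpolation n \<Omega> \<Phi> N x w lam f)
       \<and> hyperinterpolation n \<Omega> \<Phi> N x w (hard_hyperinterpolation n \<Omega> \<Phi> N x w lam f)
           = hard_hyperinterpolation n \<Omega> \<Phi> N x w lam f"
  \<comment> \<open>The outer operator recovers the inner coefficients. Those of
    \<open>hyperinterpolation\<close> are then thresholded once; thresholded ones are either kept or
    thresholded again without change.\<close>
  using discrete_inner_basis_expansion[OF assms(5,7)]
  by (simp add: hard_hyperinterpolation_def hyperinterpolation_def hard_threshold_idem)

end
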